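(* Let $A^{+}, B^{+}$ be two free semigroups, and let $\varphi : A^{+} \to \mathbb{N}$, $\psi : B^{+} \to \mathbb{N}$ be two epimorphisms. Then the fiber product $\Pi(\varphi,\psi) = \{(u,v) \in A^{+}\times B^{+} : \varphi(u) = \psi(v)\}$ of $A^{+}$ with $B^{+}$ over $\mathbb{N}$ with respect to $\varphi,\psi$ is finitely generated if and only if either $|\varphi(A)| = 1$ or $|\psi(B)| = 1$.
   Context: $\mathbb{N} = \{1,2,3,\dots\}$ is the additive semigroup of positive integers (the free monogenic semigroup). An alphabet is a set of formal symbols (letters); for an alphabet $A$, $A^{+}$ is the free semigroup of non-empty finite words over $A$ under concatenation. "Epimorphism" means surjective homomorphism. $\Pi(\varphi,\psi)$ is a subsemigroup of the direct product $A^{+}\times B^{+}$, and finite generation is meant as a semigroup. $\varphi(A)$ denotes the set of images of the letters of $A$, and similarly $\psi(B)$.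
   Formalization: The alphabets A and B are assumed finite; for infinite A with every letter sent to 1 by φ, |φ(A)| = 1 but the pairs (a,b) with ψ(b) = 1 are infinitely many indecomposables, so the fiber product is not finitely generated and the claim as stated fails. *)

theory Defs
  imports Main
begin

text \<open>Semigroups are given by a carrier set together with a binary operation.\<close>

definition semigroup_on :: "'a set \<Rightarrow> ('a \<Rightarrow> 'a \<Rightarrow> 'a) \<Rightarrow> bool" where
  "semigroup_on S f \<longleftrightarrow>
     (\<forall>x\<in>S. \<forall>y\<in>S. f x y \<in> S) \<and>
     (\<forall>x\<in>S. \<forall>y\<in>S. \<forall>z\<in>S. f (f x y) z = f x (f y z))"

definition semigroup_hom ::
  "'a set \<Rightarrow> ('a \<Rightarrow> 'a \<Rightarrow> 'a) \<Rightarrow> 'b set \<Rightarrow> ('b \<Rightarrow> 'b \<Rightarrow> 'b) \<Rightarrow> ('a \<Rightarrow> 'b) \<Rightarrow> bool" where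
  "semigroup_hom S f T g h \<longleftrightarrow>
     (\<forall>x\<in>S. h x \<in> T) \<and> (\<forall>x\<in>S. \<forall>y\<in>S. h (f x y) = g (h x) (h y))"

definition semigroup_epi ::
  "'a set \<Rightarrow> ('a \<Rightarrow> 'a \<Rightarrow> 'a) \<Rightarrow> 'b set \<Rightarrow> ('b \<Rightarrow> 'b \<Rightarrow> 'b) \<Rightarrow> ('a \<Rightarrow> 'b) \<Rightarrow> bool" where
  "semigroup_epi S f T g h \<longleftrightarrow> semigroup_hom S f T g h \<and> h ` S = T"

inductive_set subsemigroup_generated :: "('a \<Rightarrow> 'a \<Rightarrow> 'a) \<Rightarrow> 'a set \<Rightarrow> 'a set"
  for f :: "'a \<Rightarrow> 'a \<Rightarrow> 'a" and X :: "'a set" where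
  generator: "x \<in> X \<Longrightarrow> x \<in> subsemigroup_generated f X"
| product: "\<lbrakk>x \<in> subsemigroup_generated f X; y \<in> subsemigroup_generated f X\<rbrakk>
    \<Longrightarrow> f x y \<in> subsemigroup_generated f X"

definition finitely_generated_semigroup :: "'a set \<Rightarrow> ('a \<Rightarrow> 'a \<Rightarrow> 'a) \<Rightarrow> bool" where
  "finitely_generated_semigroup S f \<longleftrightarrow>
     (\<exists>X. finite X \<and> X \<subseteq> S \<and> subsemigroup_generated f X = S)"

definition prod_op ::
  "('a \<Rightarrow> 'a \<Rightarrow> 'a) \<Rightarrow> ('b \<Rightarrow> 'b \<Rightarrow> 'b) \<Rightarrow> 'a \<times> 'b \<Rightarrow> 'a \<times> 'b \<Rightarrow> 'a \<times> 'b" where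
  "prod_op f g p q = (f (fst p) (fst q), g (snd p) (snd q))"

definition fiber_product :: "'a set \<Rightarrow> 'b set \<Rightarrow> ('a \<Rightarrow> 'c) \<Rightarrow> ('b \<Rightarrow> 'c) \<Rightarrow> ('a \<times> 'b) set" where
  "fiber_product S T h k = {(u, v). u \<in> S \<and> v \<in> T \<and> h u = k v}"

text \<open>Words are lists, a letter \<open>a\<close> being the one-element word \<open>[a]\<close>; the free semigroup has
  the operation \<open>(@)\<close>.\<close>

definition free_semigroup :: "'a set \<Rightarrow> 'a list set" where
  "free_semigroup A = lists A - {[]}"

definition letters :: "'a set \<Rightarrow> 'a list set" where
  "letters A = (\<lambda>a. [a]) ` A"

text \<open>The free monogenic semigroup, with the operation \<open>(+)\<close>.\<close>

definition pos_nat :: "nat set" where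
  "pos_nat = {n. 1 \<le> n}"

lemma semigroup_on_free_semigroup: "semigroup_on (free_semigroup A) (@)"
  by (auto simp: semigroup_on_def free_semigroup_def)

lemma semigroup_on_pos_nat: "semigroup_on pos_nat (+)"
  by (auto simp: semigroup_on_def pos_nat_def)

lemma semigroup_on_fiber_product:
  assumes "semigroup_on S f" "semigroup_on T g"
    and "semigroup_hom S f U m h" "semigroup_hom T g U m k"
  shows "semigroup_on (fiber_product S T h k) (prod_op f g)"
  using assms by (auto simp: semigroup_on_def semigroup_hom_def fiber_product_def prod_op_def)

end

theory Submission
  imports Defs
begin

text \<open>A homomorphism from a free semigroup to the positive integers is a weight: it is additive
  over the letters of a word. It is surjective exactly when some letter has weight 1, because a word
  of weight 1 cannot have two letters. So \<open>card (\<phi> ` letters A) = 1\<close> says that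
  all letters of \<open>A\<close> have weight 1, that is, that \<open>\<phi>\<close> is word length.

  If \<open>\<phi>\<close> is word length, a pair \<open>(u, v)\<close> of the fiber product can be cut at every letter of
  \<open>v\<close>, since \<open>u\<close> has a prefix of every length. So the pairs whose second component
  is a single letter generate; they are finitely many, because their first components are words of
  bounded length over a finite alphabet (\<open>finitely_generated_if_length\<close>).

  If neither homomorphism is word length, there are letters \<open>a\<close>, \<open>b\<close> of weight 1 and letters
  \<open>c\<close>, \<open>d\<close> of weights \<open>p \<ge> 2\<close> and \<open>q \<ge> 2\<close> on the two sides. By symmetry let \<open>p \<le> q\<close>. A pair
  decomposes in the fiber product only if proper prefixes of its two components have the same
  weight. The prefixes of a power of \<open>d\<close> have as weights the multiples of \<open>q\<close>. On the other side, a
  heavy letter \<open>c\<close> can be used to jump over each multiple of \<open>q\<close>: the word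
  \<open>a (a\<^sup>q\<^sup>-\<^sup>p c)\<^sup>n a\<^sup>q\<^sup>-\<^sup>1\<close> has weight \<open>(n + 1) q\<close>, but no proper non-empty prefix has weight
  divisible by \<open>q\<close>. Paired with the power of \<open>d\<close> of the same weight, it gives an indecomposable
  element for every \<open>n\<close>, and every generating set contains all of these.\<close>

section \<open>Generated subsemigroups\<close>

lemma subsemigroup_generated_subset:
  assumes "semigroup_on S f" "X \<subseteq> S"
  shows "subsemigroup_generated f X \<subseteq> S"
proof
  fix x assume "x \<in> subsemigroup_generated f X"
  then show "x \<in> S"
    by induction (use assms in \<open>auto simp: semigroup_on_def\<close>)
qed

lemma subsemigroup_generated_image:
  assumes hom: "\<And>x y. h (f x y) = g (h x) (h y)"
  shows "subsemigroup_generated g (h ` X) = h ` subsemigroup_generated f X"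
proof (intro equalityI subsetI)
  fix z assume "z \<in> subsemigroup_generated g (h ` X)"
  then show "z \<in> h ` subsemigroup_generated f X"
  proof induction
    case (generator x)
    then show ?case by (auto intro: subsemigroup_generated.generator)
  next
    case (product x y)
    then obtain x' y' where "x = h x'" "y = h y'" 
      "x' \<in> subsemigroup_generated f X" "y' \<in> subsemigroup_generated f X" by blast
    then show ?case
      by (metis hom imageI subsemigroup_generated.product)
  qed
next
  fix z assume "z \<in> h ` subsemigroup_generated f X"
  moreover have "h x \<in> subsemigroup_generated g (h ` X)" if "x \<in> subsemigroup_generated f X" for x
    using that by induction (auto simp: hom intro: subsemigroup_generated.intros)
  ultimately show "z \<in> subsemigroup_generated g (h ` X)" by blast
qed

lemma finitely_generated_fiber_product_swap:
  assumes "finitely_generated_semigroup (fiber_product S T h k) (prod_op f g)"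
  shows "finitely_generated_semigroup (fiber_product T S k h) (prod_op g f)"
proof -
  from assms obtain X where X: "finite X" "X \<subseteq> fiber_product S T h k"
    "subsemigroup_generated (prod_op f g) X = fiber_product S T h k"
    unfolding finitely_generated_semigroup_def by blast
  have swap: "prod.swap ` fiber_product S T h k = fiber_product T S k h"
    by (force simp: fiber_product_def)
  have "subsemigroup_generated (prod_op g f) (prod.swap ` X)
      = prod.swap ` subsemigroup_generated (prod_op f g) X"
    by (rule subsemigroup_generated_image) (simp add: prod_op_def)
  then have "subsemigroup_generated (prod_op g f) (prod.swap ` X) = fiber_product T S k h"
    by (simp only: X(3) swap)
  moreover have "finite (prod.swap ` X)" using X(1) by (rule finite_imageI)
  moreover have "prod.swap ` X \<subseteq> fiber_product T S k h"
    unfolding swap[symmetric] using X(2) by (rule image_mono)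
  ultimately show ?thesis unfolding finitely_generated_semigroup_def by blast
qed

text \<open>An indecomposable element cannot arise by the product rule, so it lies in every generating
  set.\<close>

lemma not_finitely_generated_if_infinite_indecomposables:
  assumes "infinite I" "I \<subseteq> S"
    and indecomposable: "\<And>x y. x \<in> S \<Longrightarrow> y \<in> S \<Longrightarrow> f x y \<notin> I"
  shows "\<not> finitely_generated_semigroup S f"
proof
  assume "finitely_generated_semigroup S f"
  then obtain X where X: "finite X" "subsemigroup_generated f X = S"
    unfolding finitely_generated_semigroup_def by blast
  have "I \<subseteq> X"
  proof
    fix z assume "z \<in> I"
    then have "z \<in> subsemigroup_generated f X" using assms(2) X(2) by blast
    then show "z \<in> X"
    proof cases
      case (product x y)
      then show ?thesis using indecomposable \<open>z \<in> I\<close> X(2) by blast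
    qed
  qed
  then show False using \<open>infinite I\<close> X(1) finite_subset by blast
qed

section \<open>Homomorphisms from a free semigroup to the positive integers\<close>

lemma letter_in_free_semigroup: "[a] \<in> free_semigroup A \<longleftrightarrow> a \<in> A"
  by (auto simp: free_semigroup_def)

lemma letter_weight_pos:
  assumes "semigroup_hom (free_semigroup A) (@) pos_nat (+) \<phi>" "a \<in> A"
  shows "1 \<le> \<phi> [a]"
  using assms letter_in_free_semigroup[of a A] unfolding semigroup_hom_def pos_nat_def by blast

lemma hom_eq_sum_letter_weights:
  assumes hom: "semigroup_hom (free_semigroup A) (@) pos_nat (+) \<phi>"
    and "u \<in> free_semigroup A"
  shows "\<phi> u = (\<Sum>a\<leftarrow>u. \<phi> [a])"
  using assms(2)
proof (induction u)
  case Nil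
  then show ?case by (simp add: free_semigroup_def)
next
  case (Cons a u)
  show ?case
  proof (cases "u = []")
    case False
    with Cons.prems have a: "[a] \<in> free_semigroup A" and u: "u \<in> free_semigroup A"
      by (auto simp: free_semigroup_def)
    with hom have "\<phi> ([a] @ u) = \<phi> [a] + \<phi> u" unfolding semigroup_hom_def by blast
    with Cons.IH[OF u] show ?thesis by simp
  qed simp
qed

lemma epi_obtains_unit_letter:
  assumes epi: "semigroup_epi (free_semigroup A) (@) pos_nat (+) \<phi>"
  obtains a where "a \<in> A" "\<phi> [a] = 1"
proof -
  from epi have hom: "semigroup_hom (free_semigroup A) (@) pos_nat (+) \<phi>"
    and "\<phi> ` free_semigroup A = pos_nat" by (auto simp: semigroup_epi_def)
  moreover have "1 \<in> pos_nat" by (simp add: pos_nat_def)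
  ultimately obtain u where u: "u \<in> free_semigroup A" "\<phi> u = 1" by (metis imageE)
  then obtain a v where av: "u = a # v" by (cases u) (auto simp: free_semigroup_def)
  with u have a: "a \<in> A" by (auto simp: free_semigroup_def)
  have "\<phi> [a] \<le> \<phi> u" using hom_eq_sum_letter_weights[OF hom u(1)] av by simp
  with letter_weight_pos[OF hom a] u(2) have "\<phi> [a] = 1" by simp
  with a show thesis by (rule that)
qed

lemma card_letter_weights_eq_1_iff:
  assumes "semigroup_epi (free_semigroup A) (@) pos_nat (+) \<phi>"
  shows "card (\<phi> ` letters A) = 1 \<longleftrightarrow> (\<forall>a\<in>A. \<phi> [a] = 1)"
proof -
  obtain a where a: "a \<in> A" "\<phi> [a] = 1" using epi_obtains_unit_letter[OF assms] .
  then have one: "1 \<in> \<phi> ` letters A" by (force simp: letters_def)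
  have "card (\<phi> ` letters A) = 1 \<longleftrightarrow> \<phi> ` letters A = {1}"
    using one by (metis card_1_singletonE is_singletonI is_singleton_altdef singletonD)
  also have "\<dots> \<longleftrightarrow> (\<forall>a\<in>A. \<phi> [a] = 1)"
    using one by (auto simp: letters_def)
  finally show ?thesis .
qed

section \<open>Finite generation when one homomorphism is word length\<close>

text \<open>Induction on \<open>v\<close>: below the first letter \<open>b\<close> of \<open>v\<close>, the word \<open>u\<close> is cut after \<open>\<psi> [b]\<close>
  letters. No generator has an empty first component, because \<open>\<psi>\<close> is positive.\<close>

lemma finitely_generated_if_length:
  assumes "finite A" "finite B"
    and homA: "semigroup_hom (free_semigroup A) (@) pos_nat (+) \<phi>"
    and homB: "semigroup_hom (free_semigroup B) (@) pos_nat (+) \<psi>"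
    and unit: "\<And>a. a \<in> A \<Longrightarrow> \<phi> [a] = 1"
  shows "finitely_generated_semigroup
           (fiber_product (free_semigroup A) (free_semigroup B) \<phi> \<psi>) (prod_op (@) (@))"
proof -
  let ?P = "fiber_product (free_semigroup A) (free_semigroup B) \<phi> \<psi>"
  define X where "X = (\<Union>b\<in>B. (\<lambda>u. (u, [b])) ` {u. set u \<subseteq> A \<and> length u = \<psi> [b]})"
  have len: "\<phi> u = length u" if "u \<in> free_semigroup A" for u
  proof -
    have "map (\<lambda>a. \<phi> [a]) u = map (\<lambda>a. 1) u"
      using that unit by (auto simp: free_semigroup_def)
    then show ?thesis 
      using hom_eq_sum_letter_weights[OF homA that] by (metis sum_list_triv mult.right_neutral of_nat_id)
  qed
  have "finite X"
    unfolding X_def using assms(1,2) by (intro finite_UN_I finite_imageI finite_lists_length_eq)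
  moreover have XP: "X \<subseteq> ?P"
  proof
    fix z assume "z \<in> X"
    then obtain u b where z: "z = (u, [b])" and b: "b \<in> B" and u: "set u \<subseteq> A" "length u = \<psi> [b]"
      unfolding X_def by blast
    have "u \<noteq> []" using u letter_weight_pos[OF homB b] by auto
    with u have "u \<in> free_semigroup A" by (auto simp: free_semigroup_def)
    with z b u len show "z \<in> ?P" by (auto simp: fiber_product_def letter_in_free_semigroup)
  qed
  moreover have "?P \<subseteq> subsemigroup_generated (prod_op (@) (@)) X"
  proof -
    have "(u, v) \<in> subsemigroup_generated (prod_op (@) (@)) X"
      if "set u \<subseteq> A" "v \<in> free_semigroup B" "length u = \<psi> v" for u v
      using that
    proof (induction v arbitrary: u)
      case Nil
      then show ?case by (simp add: free_semigroup_def)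
    next
      case (Cons b v)
      from Cons.prems have b: "b \<in> B" by (auto simp: free_semigroup_def)
      have gen: "(u', [b]) \<in> subsemigroup_generated (prod_op (@) (@)) X"
        if "set u' \<subseteq> A" "length u' = \<psi> [b]" for u'
        using that b unfolding X_def by (intro subsemigroup_generated.generator) auto
      show ?case
      proof (cases "v = []")
        case True
        then show ?thesis using gen Cons.prems by simp
      next
        case False
        with Cons.prems have v: "v \<in> free_semigroup B" by (auto simp: free_semigroup_def)
        have "\<psi> ([b] @ v) = \<psi> [b] + \<psi> v"
          using homB b v letter_in_free_semigroup[of b B] unfolding semigroup_hom_def by blast
        with Cons.prems have l: "length u = \<psi> [b] + \<psi> v" by simp
        have "(take (\<psi> [b]) u, [b]) \<in> subsemigroup_generated (prod_op (@) (@)) X"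
          using Cons.prems(1) l set_take_subset[of "\<psi> [b]" u] by (intro gen) auto
        moreover have "(drop (\<psi> [b]) u, v) \<in> subsemigroup_generated (prod_op (@) (@)) X"
          using Cons.prems(1) l v set_drop_subset[of "\<psi> [b]" u] by (intro Cons.IH) auto
        moreover have "(u, b # v) = prod_op (@) (@) (take (\<psi> [b]) u, [b]) (drop (\<psi> [b]) u, v)"
          by (simp add: prod_op_def)
        ultimately show ?thesis by (simp only: subsemigroup_generated.product)
      qed
    qed
    then show ?thesis
      using len by (auto simp: fiber_product_def free_semigroup_def in_lists_conv_set subset_iff)
  qed
  moreover have "subsemigroup_generated (prod_op (@) (@)) X \<subseteq> ?P"
    by (intro subsemigroup_generated_subset XP semigroup_on_fiber_product[OF _ _ homA homB]
        semigroup_on_free_semigroup)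
  ultimately show ?thesis unfolding finitely_generated_semigroup_def by blast
qed

section \<open>Infinitely many indecomposable elements\<close>

text \<open>One letter \<open>a\<close> will stand in front of this word, so that each block starts and ends just
  after a multiple of \<open>q\<close>. It is left out here to make the family of words recursive in \<open>n\<close>.\<close>

definition skipping_word :: "'a \<Rightarrow> 'a \<Rightarrow> nat \<Rightarrow> nat \<Rightarrow> nat \<Rightarrow> 'a list" where
  "skipping_word a c p q n =
     concat (replicate n (replicate (q - p) a @ [c])) @ replicate (q - 1) a"

lemma skipping_word_Suc:
  "skipping_word a c p q (Suc n) = (replicate (q - p) a @ [c]) @ skipping_word a c p q n"
  by (simp add: skipping_word_def)

lemma set_skipping_word: "set (skipping_word a c p q n) \<subseteq> {a, c}"
  by (auto simp: skipping_word_def)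

lemma sum_skipping_word:
  assumes "w a = 1" "w c = p" "2 \<le> p" "p \<le> q"
  shows "Suc (\<Sum>x\<leftarrow>skipping_word a c p q n. w x) = Suc n * q"
proof (induction n)
  case 0
  then show ?case using assms by (simp add: skipping_word_def sum_list_replicate)
next
  case (Suc n)
  have "(\<Sum>x\<leftarrow>skipping_word a c p q (Suc n). w x) = q + (\<Sum>x\<leftarrow>skipping_word a c p q n. w x)"
    using assms by (simp add: skipping_word_Suc sum_list_replicate)
  with Suc.IH show ?case by simp
qed

text \<open>The weights are offset by 1 for a letter \<open>a\<close> in front of the word. A proper
  prefix within one block \<open>a\<^sup>q\<^sup>-\<^sup>p c\<close> is a power of \<open>a\<close> with offset weight between 1 and
  \<open>q - p + 1 < q\<close>; a full block has weight \<open>q\<close> and does not change the residue.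
  A proper prefix of the final \<open>a\<^sup>q\<^sup>-\<^sup>1\<close> has offset weight between 1 and \<open>q - 1\<close>.\<close>

lemma skipping_word_proper_prefix:
  assumes w: "w a = 1" "w c = p" "2 \<le> p" "p \<le> q"
    and "skipping_word a c p q n = x @ y" "y \<noteq> []"
  shows "\<not> q dvd Suc (\<Sum>z\<leftarrow>x. w z)"
proof -
  have prefix: "(\<Sum>z\<leftarrow>x. w z) = length x" "length x + length y = k"
    if "replicate k a = x @ y" for k x y
  proof -
    show "length x + length y = k" using arg_cong[OF that, of length] by simp
    have "set x \<subseteq> {a}" using arg_cong[OF that, of set] by (auto split: if_splits)
    then show "(\<Sum>z\<leftarrow>x. w z) = length x" by (induction x) (use w in auto)
  qed
  show ?thesis
    using assms(5,6)
  proof (induction n arbitrary: x)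
    case 0
    then have eq: "replicate (q - 1) a = x @ y" by (simp add: skipping_word_def)
    then have "(\<Sum>z\<leftarrow>x. w z) = length x" "length x + length y = q - 1"
      by (rule prefix)+
    then have "0 < Suc (\<Sum>z\<leftarrow>x. w z)" "Suc (\<Sum>z\<leftarrow>x. w z) < q"
      using 0(2) by (cases y; simp)+
    then show ?case by (rule nat_dvd_not_less)
  next
    case (Suc n)
    let ?blk = "replicate (q - p) a @ [c]"
    from Suc.prems have "?blk @ skipping_word a c p q n = x @ y" by (simp add: skipping_word_Suc)
    then consider (long) x' where "x = ?blk @ x'" "skipping_word a c p q n = x' @ y"
      | (short) y' where "y' \<noteq> []" "?blk = x @ y'"
    proof -
      from \<open>?blk @ skipping_word a c p q n = x @ y\<close>
      obtain us where "(?blk = x @ us \<and> us @ skipping_word a c p q n = y) \<or>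
          (?blk @ us = x \<and> skipping_word a c p q n = us @ y)"
        unfolding append_eq_append_conv2[of ?blk] by blast
      with that show thesis by (cases "us = []") auto
    qed
    then show ?case
    proof cases
      case long
      have "Suc (\<Sum>z\<leftarrow>x. w z) = q + Suc (\<Sum>z\<leftarrow>x'. w z)"
        using w by (simp add: long sum_list_replicate)
      with Suc.IH[OF long(2) Suc.prems(2)] show ?thesis
        by (metis dvd_add_triv_left_iff)
    next
      case short
      then obtain y'' where eq: "replicate (q - p) a = x @ y''"
        by (metis append_assoc append_butlast_last_id butlast_append butlast_snoc)
      then have "(\<Sum>z\<leftarrow>x. w z) = length x" "length x + length y'' = q - p"
        by (rule prefix)+
      with w have "0 < Suc (\<Sum>z\<leftarrow>x. w z)" "Suc (\<Sum>z\<leftarrow>x. w z) < q" by auto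
      then show ?thesis by (rule nat_dvd_not_less)
    qed
  qed
qed

text \<open>If a skipping word, preceded by \<open>a\<close>, and a power of \<open>d\<close> were cut into a product in the fiber
  product, the first factor would give a proper prefix of the former whose weight is that of a power
  of \<open>d\<close>, a multiple of the weight of \<open>d\<close>.\<close>

lemma not_finitely_generated_if_heavy_letters:
  assumes homA: "semigroup_hom (free_semigroup A) (@) pos_nat (+) \<phi>"
    and homB: "semigroup_hom (free_semigroup B) (@) pos_nat (+) \<psi>"
    and A: "a \<in> A" "c \<in> A" and d: "d \<in> B"
    and w: "\<phi> [a] = 1" "2 \<le> \<phi> [c]" "\<phi> [c] \<le> \<psi> [d]"
  shows "\<not> finitely_generated_semigroup
           (fiber_product (free_semigroup A) (free_semigroup B) \<phi> \<psi>) (prod_op (@) (@))"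
proof -
  let ?P = "fiber_product (free_semigroup A) (free_semigroup B) \<phi> \<psi>"
  let ?q = "\<psi> [d]"
  define e where "e n = (a # skipping_word a c (\<phi> [c]) ?q n, replicate (Suc n) d)" for n
  have powers: "?q dvd \<psi> v" if "v \<in> free_semigroup B" "set v \<subseteq> {d}" for v
  proof -
    have "v = replicate (length v) d" using that by (metis replicate_length_same singletonD subsetD)
    then have "(\<Sum>b\<leftarrow>v. \<psi> [b]) = length v * ?q"
      by (metis map_replicate sum_list_replicate of_nat_id)
    then show ?thesis using hom_eq_sum_letter_weights[OF homB that(1)] by simp
  qed
  have "range e \<subseteq> ?P"
  proof
    fix z assume "z \<in> range e"
    then obtain n where z: "z = e n" by blast
    have u: "a # skipping_word a c (\<phi> [c]) ?q n \<in> free_semigroup A"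
      using set_skipping_word[of a c "\<phi> [c]" ?q n] A by (auto simp: free_semigroup_def)
    have v: "replicate (Suc n) d \<in> free_semigroup B"
      using d by (auto simp: free_semigroup_def)
    have "\<phi> (a # skipping_word a c (\<phi> [c]) ?q n) = Suc n * ?q"
      using hom_eq_sum_letter_weights[OF homA u] sum_skipping_word[of "\<lambda>x. \<phi> [x]" a c "\<phi> [c]" ?q n] w
      by simp
    moreover have "\<psi> (replicate (Suc n) d) = Suc n * ?q"
      unfolding hom_eq_sum_letter_weights[OF homB v] map_replicate sum_list_replicate by simp
    ultimately show "z \<in> ?P" using u v z by (simp add: e_def fiber_product_def)
  qed
  moreover have "infinite (range e)"
  proof -
    have "inj e"
      by (rule injI) (metis e_def length_replicate nat.inject prod.inject)
    then show ?thesis by (simp add: finite_image_iff)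
  qed
  moreover have "prod_op (@) (@) x y \<notin> range e" if x: "x \<in> ?P" and y: "y \<in> ?P" for x y
  proof
    assume "prod_op (@) (@) x y \<in> range e"
    then obtain n where "prod_op (@) (@) x y = e n" by blast
    then have eq: "a # skipping_word a c (\<phi> [c]) ?q n = fst x @ fst y"
      "replicate (Suc n) d = snd x @ snd y"
      unfolding prod_op_def e_def by auto
    from x y have mem: "fst x \<in> free_semigroup A" "snd x \<in> free_semigroup B"
      "\<phi> (fst x) = \<psi> (snd x)" "fst y \<noteq> []"
      by (auto simp: fiber_product_def free_semigroup_def)
    then obtain x' where x': "fst x = a # x'" "skipping_word a c (\<phi> [c]) ?q n = x' @ fst y"
      using eq(1) by (cases "fst x") (auto simp: free_semigroup_def)
    have "set (snd x) \<subseteq> set (replicate (Suc n) d)" unfolding eq(2) by simp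
    then have "?q dvd \<psi> (snd x)" using mem by (intro powers) auto
    moreover have "\<phi> (fst x) = Suc (\<Sum>z\<leftarrow>x'. \<phi> [z])"
      using hom_eq_sum_letter_weights[OF homA mem(1)] x' w by simp
    moreover have "\<not> ?q dvd Suc (\<Sum>z\<leftarrow>x'. \<phi> [z])"
      using skipping_word_proper_prefix[of "\<lambda>x. \<phi> [x]", OF _ _ _ _ x'(2) mem(4)] w by simp
    ultimately show False using mem(3) by simp
  qed
  ultimately show ?thesis by (intro not_finitely_generated_if_infinite_indecomposables)
qed

section \<open>Characterization of finite generation\<close>

theorem theorem4p6:
  fixes A :: "'a set" and B :: "'b set"
    and \<phi> :: "'a list \<Rightarrow> nat" and \<psi> :: "'b list \<Rightarrow> nat"
  assumes "finite A" and "finite B"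
    and "semigroup_epi (free_semigroup A) (@) pos_nat (+) \<phi>"
    and "semigroup_epi (free_semigroup B) (@) pos_nat (+) \<psi>"
  shows "finitely_generated_semigroup
           (fiber_product (free_semigroup A) (free_semigroup B) \<phi> \<psi>) (prod_op (@) (@))
         \<longleftrightarrow> card (\<phi> ` letters A) = 1 \<or> card (\<psi> ` letters B) = 1"
proof
  from assms have homA: "semigroup_hom (free_semigroup A) (@) pos_nat (+) \<phi>"
    and homB: "semigroup_hom (free_semigroup B) (@) pos_nat (+) \<psi>"
    by (auto simp: semigroup_epi_def)
  note iffs = card_letter_weights_eq_1_iff[OF assms(3)] card_letter_weights_eq_1_iff[OF assms(4)]
  {
    assume fg: "finitely_generated_semigroup
      (fiber_product (free_semigroup A) (free_semigroup B) \<phi> \<psi>) (prod_op (@) (@))"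
    show "card (\<phi> ` letters A) = 1 \<or> card (\<psi> ` letters B) = 1"
    proof (rule ccontr)
      assume "\<not> ?thesis"
      then obtain c d where c: "c \<in> A" "\<phi> [c] \<noteq> 1" and d: "d \<in> B" "\<psi> [d] \<noteq> 1"
        unfolding iffs by blast
      have heavy: "2 \<le> \<phi> [c]" "2 \<le> \<psi> [d]"
        using c d letter_weight_pos[OF homA c(1)] letter_weight_pos[OF homB d(1)] by auto
      obtain a where a: "a \<in> A" "\<phi> [a] = 1" using epi_obtains_unit_letter[OF assms(3)] .
      obtain b where b: "b \<in> B" "\<psi> [b] = 1" using epi_obtains_unit_letter[OF assms(4)] .
      show False
      proof (cases "\<phi> [c] \<le> \<psi> [d]")
        case True
        then show False
          using not_finitely_generated_if_heavy_letters[OF homA homB] a c d heavy fg by blast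
      next
        case False
        then have "\<psi> [d] \<le> \<phi> [c]" by simp
        then show False
          using not_finitely_generated_if_heavy_letters[OF homB homA] b c d heavy
            finitely_generated_fiber_product_swap[OF fg] by blast
      qed
    qed
  next
    assume "card (\<phi> ` letters A) = 1 \<or> card (\<psi> ` letters B) = 1"
    then show "finitely_generated_semigroup
      (fiber_product (free_semigroup A) (free_semigroup B) \<phi> \<psi>) (prod_op (@) (@))"
      unfolding iffs
    proof
      assume "\<forall>a\<in>A. \<phi> [a] = 1"
      then show ?thesis by (intro finitely_generated_if_length assms homA homB) auto
    next
      assume "\<forall>b\<in>B. \<psi> [b] = 1"
      then show ?thesis
        using finitely_generated_fiber_product_swap finitely_generated_if_length[OF assms(2,1) homB homA]
        by blast
    qed
  }
qed

end
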